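(* Let $u,v:\mathbb{C}\to\mathbb{R}$ be harmonic, $f=u+iv$, and suppose $u$ is a nonconstant harmonic polynomial. Suppose there exist $a>0$ and $R>0$ such that $$f(\mathbb{C}\setminus D(0,R))\subset\{u+iv:\ |u|\le a|v|\},$$ i.e. $|u(z)|\le a|v(z)|$ for all $|z|\ge R$. Then there exists $b\in\mathbb{R}$ with $|b|\le a$ such that $u=bv$. In particular $v$ is also a polynomial and $f(\mathbb{C})$ is a line.
   Context: $D(z_0,r)$ denotes the open disc of center $z_0$ and radius $r$. *)

theory Defs
  imports "HOL-Analysis.Analysis"
begin

text \<open>A function u : C -> R (C viewed as R^2) is harmonic if it is C^2 and its
Laplacian u_xx + u_yy vanishes everywhere.  Here u' z is the Frechet derivative
at z and u'' z h k is the second derivative applied to directions h, k;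
the directions 1 and i are the x- and y-directions.\<close>
definition harmonic_C :: "(complex \<Rightarrow> real) \<Rightarrow> bool" where
  "harmonic_C u \<longleftrightarrow>
     (\<exists>u' u''.
        (\<forall>z. (u has_derivative u' z) (at z)) \<and>
        (\<forall>z h. ((\<lambda>w. u' w h) has_derivative u'' z h) (at z)) \<and>
        (\<forall>h k. continuous_on UNIV (\<lambda>z. u'' z h k)) \<and>
        (\<forall>z. u'' z 1 1 + u'' z \<i> \<i> = 0))"

definition poly_C :: "(complex \<Rightarrow> real) \<Rightarrow> bool" where
  "poly_C u \<longleftrightarrow>
     (\<exists>(n::nat) (c::nat \<Rightarrow> nat \<Rightarrow> real).
        \<forall>z. u z = (\<Sum>i\<le>n. \<Sum>j\<le>n. c i j * Re z ^ i * Im z ^ j))"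

end

theory Submission
  imports Defs "HOL-Complex_Analysis.Complex_Analysis"
begin

text \<open>Write $u = \mathrm{Re}\,F$ and $v = \mathrm{Re}\,G$ with $F$ a polynomial of degree $n$ and $G$ entire.
  Outside the disc every zero of $v$ is a zero of $u$, and $u$ has at most $2n$ zeros on each circle about
  the origin. The key fact is that an entire $G$ whose real part has at most $2d$ zeros on every large
  circle is a polynomial of degree at most $d$. So $\deg G \le n$. Comparing leading terms along rays
  gives a real $b$, $|b| \le a$, such that $\deg(F - bG) < n$; the key fact with $d = n - 1$,
  applied to the common zeros of $v$ and $u - bv$, then leaves only $u = bv$.\<close>

subsection \<open>Harmonic functions as real parts\<close>

text \<open>The hypothesis bounds \<open>u\<close> by \<open>v\<close>, hence gives no upper bound
  on the growth of \<open>v\<close>; all it says about \<open>v\<close> is that far out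
  \<open>v\<close> cannot vanish where \<open>u\<close> does not. Growth therefore has to be
  extracted from a count of zeros. What makes this possible is that, up to the factor
  \<open>r ^ k / 2\<close>, the Taylor coefficients of \<open>G\<close> with positive index are the
  Fourier coefficients of \<open>v\<close> on the circle of radius \<open>r\<close>, so a single
  high coefficient can be isolated and compared with the lower ones as \<open>r\<close> grows. The
  same count serves twice because it is sharp in the degree: 2n zeros per circle still allow a term
  of degree n in \<open>G\<close>, while 2(n - 1) zeros exclude it. This is why one cancelled
  leading term of \<open>u - b v\<close> suffices and no induction on the degree is required. With
  no zeros at all the count also shows that \<open>v\<close> takes every real value, so that the
  image is the whole line and not just a part of it.\<close>

lemma second_difference_mvt:
  fixes u :: "'a::real_normed_vector \<Rightarrow> real"
  assumes u': "\<And>z. (u has_derivative u' z) (at z)"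
    and u'': "\<And>z h. ((\<lambda>w. u' w h) has_derivative u'' z h) (at z)"
    and "s > 0"
  obtains x y where "0 < x" "x < s" "0 < y" "y < s"
    "u (z + s *\<^sub>R h + s *\<^sub>R k) - u (z + s *\<^sub>R h) - u (z + s *\<^sub>R k) + u z
       = s\<^sup>2 * u'' (z + x *\<^sub>R h + y *\<^sub>R k) h k"
proof -
  \<comment> \<open>The second difference is \<open>g s - g 0\<close>. One mean value step in
    direction \<open>h\<close> and one in direction \<open>k\<close> turn it into a value of the
    second derivative.\<close>
  define g where "g = (\<lambda>x. u (z + x *\<^sub>R h + s *\<^sub>R k) - u (z + x *\<^sub>R h))"
  have scale: "x * u' w h = u' w (x *\<^sub>R h)" for w x h
    using linear_scale[OF has_derivative_linear[OF u'[of w]], of x h] by simp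
  have scale2: "x * u'' w h k = u'' w h (x *\<^sub>R k)" for w x h k
    using linear_scale[OF has_derivative_linear[OF u''[of h w]], of x k] by simp
  have dg: "(g has_field_derivative u' (z + x *\<^sub>R h + s *\<^sub>R k) h - u' (z + x *\<^sub>R h) h) (at x)" for x
    unfolding g_def has_field_derivative_def
    by (rule derivative_eq_intros has_derivative_compose[OF _ u'] refl)+
       (auto simp: algebra_simps scale)
  obtain x where x: "0 < x" "x < s" and gx:
    "g s - g 0 = (s - 0) * (u' (z + x *\<^sub>R h + s *\<^sub>R k) h - u' (z + x *\<^sub>R h) h)"
    using MVT2[OF \<open>s > 0\<close>, of g "\<lambda>x. u' (z + x *\<^sub>R h + s *\<^sub>R k) h - u' (z + x *\<^sub>R h) h"] dg by blast
  define f where "f = (\<lambda>y. u' (z + x *\<^sub>R h + y *\<^sub>R k) h)"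
  have df: "(f has_field_derivative u'' (z + x *\<^sub>R h + y *\<^sub>R k) h k) (at y)" for y
    unfolding f_def has_field_derivative_def
    by (rule has_derivative_eq_rhs[OF has_derivative_compose[where g="\<lambda>w. u' w h", OF _ u'']])
       (rule derivative_eq_intros refl | auto simp: algebra_simps scale2)+
  obtain y where y: "0 < y" "y < s" and fy:
    "f s - f 0 = (s - 0) * u'' (z + x *\<^sub>R h + y *\<^sub>R k) h k"
    using MVT2[OF \<open>s > 0\<close>, of f "\<lambda>y. u'' (z + x *\<^sub>R h + y *\<^sub>R k) h k"] df by blast
  show ?thesis
    using x y gx fy
    by (intro that[of x y]) (auto simp: g_def f_def power2_eq_square algebra_simps)
qed

text \<open>The second difference over a small parallelogram does not change when \<open>h\<close>
  and \<open>k\<close> are swapped. Evaluating it in both orders gives equal mixed derivatives at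
  two points near \<open>z\<close>, and continuity carries the equality to \<open>z\<close>
  itself.\<close>

lemma second_derivative_symmetric:
  fixes u :: "'a::real_normed_vector \<Rightarrow> real"
  assumes u': "\<And>z. (u has_derivative u' z) (at z)"
    and u'': "\<And>z h. ((\<lambda>w. u' w h) has_derivative u'' z h) (at z)"
    and cont: "\<And>h k. continuous_on UNIV (\<lambda>z. u'' z h k)"
  shows "u'' z h k = u'' z k h"
proof -
  have near: "\<exists>p q. dist p z < d \<and> dist q z < d \<and> u'' p h k = u'' q k h" if "d > 0" for d
  proof -
    define s where "s = d / (norm h + norm k + 1)"
    have pos: "norm h + norm k + 1 > 0"
      using norm_ge_zero[of h] norm_ge_zero[of k] by linarith
    have s: "s > 0" "s * (norm h + norm k) < d"
      using that pos by (auto simp: s_def field_simps)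
    have small: "dist (z + x *\<^sub>R h + y *\<^sub>R k) z < d" if "0 < x" "x < s" "0 < y" "y < s" for x y
    proof -
      have "norm (x *\<^sub>R h + y *\<^sub>R k) \<le> x * norm h + y * norm k"
        using norm_triangle_ineq[of "x *\<^sub>R h" "y *\<^sub>R k"] that by simp
      also have "\<dots> \<le> s * norm h + s * norm k"
        using that by (intro add_mono mult_right_mono) auto
      finally show ?thesis using s by (simp add: dist_norm algebra_simps)
    qed
    obtain x y where xy: "0 < x" "x < s" "0 < y" "y < s"
      "u (z + s *\<^sub>R h + s *\<^sub>R k) - u (z + s *\<^sub>R h) - u (z + s *\<^sub>R k) + u z
         = s\<^sup>2 * u'' (z + x *\<^sub>R h + y *\<^sub>R k) h k"
      using second_difference_mvt[OF u' u'' s(1)] by metis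
    obtain x' y' where xy': "0 < x'" "x' < s" "0 < y'" "y' < s"
      "u (z + s *\<^sub>R k + s *\<^sub>R h) - u (z + s *\<^sub>R k) - u (z + s *\<^sub>R h) + u z
         = s\<^sup>2 * u'' (z + x' *\<^sub>R k + y' *\<^sub>R h) k h"
      using second_difference_mvt[OF u' u'' s(1)] by metis
    have "s\<^sup>2 * u'' (z + x *\<^sub>R h + y *\<^sub>R k) h k = s\<^sup>2 * u'' (z + y' *\<^sub>R h + x' *\<^sub>R k) k h"
      using xy(5) xy'(5) by (simp add: algebra_simps)
    then have "u'' (z + x *\<^sub>R h + y *\<^sub>R k) h k = u'' (z + y' *\<^sub>R h + x' *\<^sub>R k) k h"
      using s by simp
    then show ?thesis using small xy xy' by blast
  qed
  have c: "isCont (\<lambda>z. u'' z h k) z" "isCont (\<lambda>z. u'' z k h) z"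
    using cont continuous_on_eq_continuous_at[of UNIV] by auto
  show ?thesis
  proof (rule ccontr)
    assume ne: "u'' z h k \<noteq> u'' z k h"
    define e where "e = \<bar>u'' z h k - u'' z k h\<bar> / 2"
    have "e > 0" using ne by (simp add: e_def)
    obtain d1 where d1: "d1 > 0" "\<And>p. dist p z < d1 \<Longrightarrow> \<bar>u'' p h k - u'' z h k\<bar> < e"
      using c(1) \<open>e > 0\<close> unfolding continuous_at_eps_delta dist_real_def by metis
    obtain d2 where d2: "d2 > 0" "\<And>p. dist p z < d2 \<Longrightarrow> \<bar>u'' p k h - u'' z k h\<bar> < e"
      using c(2) \<open>e > 0\<close> unfolding continuous_at_eps_delta dist_real_def by metis
    obtain p q where "dist p z < min d1 d2" "dist q z < min d1 d2" "u'' p h k = u'' q k h"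
      using near[of "min d1 d2"] d1(1) d2(1) by auto
    then show False using d1(2)[of p] d2(2)[of q] unfolding e_def by (auto simp: abs_if split: if_splits)
  qed
qed

text \<open>The function u_x - i u_y is the only possible derivative of a holomorphic function with
  real part \<open>u\<close>. Its Cauchy-Riemann equations are the Laplace equation and the symmetry
  of the second derivative. A primitive exists because the plane is convex, and its real part
  differs from \<open>u\<close> by a constant.\<close>

lemma harmonic_C_Re_holomorphic:
  assumes "harmonic_C u"
  obtains G where "G holomorphic_on UNIV" "\<And>z. u z = Re (G z)"
proof -
  obtain u' u'' where u': "\<And>z. (u has_derivative u' z) (at z)"
    and u'': "\<And>z h. ((\<lambda>w. u' w h) has_derivative u'' z h) (at z)"
    and cont: "\<And>h k. continuous_on UNIV (\<lambda>z. u'' z h k)"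
    and lap: "\<And>z. u'' z 1 1 + u'' z \<i> \<i> = 0"
    using assms unfolding harmonic_C_def by blast
  note sym = second_derivative_symmetric[OF u' u'' cont]
  have split: "L h = Re h * L 1 + Im h * L \<i>" if "linear L" for L :: "complex \<Rightarrow> real" and h
  proof -
    have "L h = L (Re h *\<^sub>R 1 + Im h *\<^sub>R \<i>)"
      by (rule arg_cong[of _ _ L]) (simp add: complex_eq_iff)
    then show ?thesis
      using that by (simp add: linear_add linear_scale del: scaleR_conv_of_real)
  qed
  define g where "g z = Complex (u' z 1) (- u' z \<i>)" for z
  have "(g has_field_derivative Complex (u'' z 1 1) (- u'' z \<i> 1)) (at z)" for z
  proof -
    have "((\<lambda>z. of_real (u' z 1) - \<i> * of_real (u' z \<i>)) has_derivative
        (\<lambda>h. of_real (u'' z 1 h) - \<i> * of_real (u'' z \<i> h))) (at z)"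
      by (rule derivative_eq_intros u'' has_derivative_of_real refl)+
    moreover have "of_real (u'' z 1 h) - \<i> * of_real (u'' z \<i> h) = Complex (u'' z 1 1) (- u'' z \<i> 1) * h" for h
      using split[OF has_derivative_linear[OF u''[of 1 z]], of h]
        split[OF has_derivative_linear[OF u''[of \<i> z]], of h] sym[of z 1 \<i>] lap[of z]
      by (auto simp: complex_eq_iff algebra_simps add_eq_0_iff)
    moreover have "g = (\<lambda>z. of_real (u' z 1) - \<i> * of_real (u' z \<i>))"
      by (auto simp: g_def complex_eq_iff)
    ultimately show ?thesis
      unfolding has_field_derivative_def by simp
  qed
  then have "g holomorphic_on UNIV"
    by (auto simp: holomorphic_on_open)
  then obtain G where G: "\<And>z. (G has_field_derivative g z) (at z)"
    using holomorphic_convex_primitive'[of UNIV g] by auto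
  have "((\<lambda>z. u z - Re (G z)) has_derivative (\<lambda>h. 0)) (at z)" for z
  proof -
    have "((\<lambda>z. u z - Re (G z)) has_derivative (\<lambda>h. u' z h - Re (g z * h))) (at z)"
      using G[of z] unfolding has_field_derivative_def
      by (intro has_derivative_diff u' has_derivative_Re)
    moreover have "u' z h - Re (g z * h) = 0" for h
      using split[OF has_derivative_linear[OF u'[of z]], of h] by (simp add: g_def algebra_simps)
    ultimately show ?thesis by simp
  qed
  then obtain c where c: "\<And>z. u z - Re (G z) = c"
    using has_derivative_zero_constant[of UNIV "\<lambda>z. u z - Re (G z)"] by auto
  show ?thesis
  proof (rule that[of "\<lambda>z. G z + of_real c"])
    show "(\<lambda>z. G z + of_real c) holomorphic_on UNIV"
      using G by (intro holomorphic_intros) (auto simp: holomorphic_on_open)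
    show "u z = Re (G z + of_real c)" for z
      using c[of z] by simp
  qed
qed

subsection \<open>Fourier coefficients on circles\<close>

definition taylor_coeff :: "(complex \<Rightarrow> complex) \<Rightarrow> nat \<Rightarrow> complex" where
  "taylor_coeff G k = (deriv ^^ k) G 0 / fact k"

text \<open>This is Cauchy's formula for the k-th derivative at 0, written out on the circle
  parametrised by the unit interval.\<close>

lemma entire_Fourier_nonneg:
  assumes "G holomorphic_on UNIV" "r > 0"
  shows "((\<lambda>t. G (of_real r * cis (2*pi*t)) * cis (- (2*pi*real k*t))) has_integral
           taylor_coeff G k * of_real r ^ k) {0..1}"
proof -
  have "((\<lambda>z. G z / (z - 0) ^ Suc k) has_contour_integral
      (2 * pi * \<i>) / fact k * (deriv ^^ k) G 0) (circlepath 0 r)"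
    using assms
    by (intro Cauchy_has_contour_integral_higher_derivative_circlepath)
       (auto intro: holomorphic_on_subset holomorphic_on_imp_continuous_on)
  then have "((\<lambda>t. G (circlepath 0 r t) / (circlepath 0 r t) ^ Suc k * vector_derivative (circlepath 0 r) (at t))
      has_integral (2 * pi * \<i>) * taylor_coeff G k) {0..1}"
    by (simp add: has_contour_integral taylor_coeff_def)
  then have "((\<lambda>t. (of_real r ^ k / (2 * pi * \<i>)) * (G (circlepath 0 r t) / (circlepath 0 r t) ^ Suc k * vector_derivative (circlepath 0 r) (at t)))
      has_integral (of_real r ^ k / (2 * pi * \<i>)) * ((2 * pi * \<i>) * taylor_coeff G k)) {0..1}"
    by (rule has_integral_mult_right)
  moreover have "(of_real r ^ k / (2 * pi * \<i>)) * (G (circlepath 0 r t) / (circlepath 0 r t) ^ Suc k * vector_derivative (circlepath 0 r) (at t))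
     = G (of_real r * cis (2*pi*t)) * cis (- (2*pi*real k*t))" for t
  proof -
    have *: "circlepath 0 r t = of_real r * cis (2*pi*t)"
      by (simp add: circlepath cis_conv_exp mult_ac)
    have **: "vector_derivative (circlepath 0 r) (at t) = 2 * pi * \<i> * (of_real r * cis (2*pi*t))"
      by (simp add: vector_derivative_circlepath cis_conv_exp mult_ac)
    have "cis (2*pi*t) ^ k * cis (- (2*pi*real k*t)) = 1"
      by (simp add: Complex.DeMoivre cis_mult)
    then have "cis (- (2*pi*real k*t)) = 1 / cis (2*pi*t) ^ k"
      by (simp add: field_simps)
    then show ?thesis using \<open>r > 0\<close>
      by (simp add: * ** field_simps power_mult_distrib)
  qed
  ultimately show ?thesis by (simp add: mult_ac)
qed

text \<open>Frequency -k of \<open>G\<close> is, up to the power of \<open>r\<close>, frequency 0 of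
  z^k G(z), and that function vanishes at the origin.\<close>

lemma entire_Fourier_neg:
  assumes "G holomorphic_on UNIV" "r > 0" "k > 0"
  shows "((\<lambda>t. G (of_real r * cis (2*pi*t)) * cis (2*pi*real k*t)) has_integral 0) {0..1}"
proof -
  have "((\<lambda>t. (of_real r * cis (2*pi*t)) ^ k * G (of_real r * cis (2*pi*t)) * cis (- (2*pi*real 0*t)))
      has_integral taylor_coeff (\<lambda>z. z ^ k * G z) 0 * of_real r ^ 0) {0..1}"
    using assms by (intro entire_Fourier_nonneg holomorphic_intros) auto
  then have "((\<lambda>t. (of_real r * cis (2*pi*t)) ^ k * G (of_real r * cis (2*pi*t))) has_integral 0) {0..1}"
    using assms(3) by (simp add: taylor_coeff_def zero_power)
  then have "((\<lambda>t. 1 / of_real r ^ k * ((of_real r * cis (2*pi*t)) ^ k * G (of_real r * cis (2*pi*t))))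
      has_integral (1 / of_real r ^ k * 0)) {0..1}"
    by (rule has_integral_mult_right)
  moreover have "1 / of_real r ^ k * ((of_real r * cis (2*pi*t)) ^ k * G (of_real r * cis (2*pi*t)))
      = G (of_real r * cis (2*pi*t)) * cis (2*pi*real k*t)" for t
  proof -
    have "cis (2*pi*t) ^ k = cis (2*pi*real k*t)"
      by (simp add: Complex.DeMoivre mult.commute mult.left_commute)
    then show ?thesis using assms(2) by (simp add: power_mult_distrib)
  qed
  ultimately show ?thesis by simp
qed

text \<open>The frequency is an integer because multiplication by a trigonometric polynomial will
  shift indices below zero.\<close>

definition Re_Fourier :: "(complex \<Rightarrow> complex) \<Rightarrow> real \<Rightarrow> int \<Rightarrow> complex" where
  "Re_Fourier G r k =
     integral {0..1} (\<lambda>t. of_real (Re (G (of_real r * cis (2*pi*t)))) * cis (- (2*pi * real_of_int k * t)))"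

text \<open>Re G is half of G plus its conjugate, and conjugation reverses frequencies. The real
  number \<open>x\<close> may have either sign or be 0, so one identity serves all
  frequencies.\<close>

lemma Re_Fourier_aux:
  assumes "((\<lambda>t. G (of_real r * cis (2*pi*t)) * cis (- (2*pi*x*t))) has_integral I) {0..1}"
    and "((\<lambda>t. G (of_real r * cis (2*pi*t)) * cis (2*pi*x*t)) has_integral J) {0..1}"
  shows "((\<lambda>t. of_real (Re (G (of_real r * cis (2*pi*t)))) * cis (- (2*pi*x*t))) has_integral (I + cnj J) / 2) {0..1}"
proof -
  have "((\<lambda>t. (G (of_real r * cis (2*pi*t)) * cis (- (2*pi*x*t)) +
       cnj (G (of_real r * cis (2*pi*t)) * cis (2*pi*x*t))) / 2) has_integral (I + cnj J) / 2) {0..1}"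
    using has_integral_divide[OF has_integral_add[OF assms(1) iffD2[OF has_integral_cnj assms(2)]], of 2]
    by (simp only: comp_def)
  moreover have "(G (of_real r * cis (2*pi*t)) * cis (- (2*pi*x*t)) +
       cnj (G (of_real r * cis (2*pi*t)) * cis (2*pi*x*t))) / 2
      = of_real (Re (G (of_real r * cis (2*pi*t)))) * cis (- (2*pi*x*t))" for t
  proof -
    have "(w * e + cnj w * e) / 2 = of_real (Re w) * e" for w e
      by (simp add: complex_eq_iff)
    then show ?thesis by (simp add: cis_cnj)
  qed
  ultimately show ?thesis by simp
qed

lemma Re_Fourier_pos:
  assumes "G holomorphic_on UNIV" "r > 0" "k > 0"
  shows "Re_Fourier G r (int k) = taylor_coeff G k * of_real r ^ k / 2"
  using Re_Fourier_aux[OF entire_Fourier_nonneg[of G r k] entire_Fourier_neg[of G r k]] assms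
  unfolding Re_Fourier_def by (intro integral_unique) simp

text \<open>For nonzero \<open>k\<close> a factor 1/2 could be kept; at \<open>k = 0\<close> both G
  and its conjugate contribute, and the bound is stated so that it covers this case too.\<close>

lemma norm_Re_Fourier_le:
  assumes "G holomorphic_on UNIV" "r > 0"
  shows "cmod (Re_Fourier G r k) \<le> cmod (taylor_coeff G (nat \<bar>k\<bar>)) * r ^ nat \<bar>k\<bar>"
proof -
  consider "k > 0" | "k = 0" | "k < 0" by linarith
  then show ?thesis
  proof cases
    case 1
    then show ?thesis
      using arg_cong[OF Re_Fourier_pos[OF assms, of "nat k"], of cmod] assms(2)
        mult_nonneg_nonneg[of "cmod (taylor_coeff G (nat k))" "r ^ nat k"]
      by (simp add: norm_mult norm_power norm_divide del: mult_nonneg_nonneg)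
  next
    case 2
    have *: "((\<lambda>t. G (of_real r * cis (2*pi*t)) * cis (- (2*pi*real 0*t))) has_integral
           taylor_coeff G 0 * of_real r ^ 0) {0..1}"
      by (intro entire_Fourier_nonneg assms)
    have "Re_Fourier G r 0 = (taylor_coeff G 0 + cnj (taylor_coeff G 0)) / 2"
      using Re_Fourier_aux[of G r 0] * unfolding Re_Fourier_def
      by (intro integral_unique) simp
    then have "cmod (Re_Fourier G r 0) = cmod (taylor_coeff G 0 + cnj (taylor_coeff G 0)) / 2"
      by (simp only: norm_divide) simp
    then have "cmod (Re_Fourier G r 0) \<le> cmod (taylor_coeff G 0)"
      using norm_triangle_ineq[of "taylor_coeff G 0" "cnj (taylor_coeff G 0)"] by simp
    then show ?thesis using 2 by simp
  next
    case 3
    define m where "m = nat (-k)"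
    have m: "m > 0" "k = - int m" using 3 by (auto simp: m_def)
    \<comment> \<open>With \<open>x = - m\<close> the two integrals trade places: the first vanishes
      and the conjugated one carries the Taylor coefficient.\<close>
    have eq: "Re_Fourier G r k = cnj (taylor_coeff G m * of_real r ^ m) / 2"
      using Re_Fourier_aux[of G r "- real m" 0 "taylor_coeff G m * of_real r ^ m"] entire_Fourier_nonneg[OF assms, of m]
        entire_Fourier_neg[OF assms m(1)] unfolding Re_Fourier_def m
      by (intro integral_unique) simp
    show ?thesis using arg_cong[OF eq, of cmod] m assms(2) mult_nonneg_nonneg[of "cmod (taylor_coeff G m)" "r ^ m"]
      by (simp add: norm_mult norm_power norm_divide del: mult_nonneg_nonneg)
  qed
qed

subsection \<open>Sign changes on circles\<close>

text \<open>\<open>S\<close> collects the points of \<open>Z\<close> at which \<open>g\<close>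
  changes sign. The induction removes the largest point \<open>s\<close> and cuts the interval
  there, which is why \<open>\<beta>\<close> is arbitrary. Beyond \<open>s\<close> there are no
  zeros, so \<open>g\<close> has one sign, and the product over the smaller points is nonnegative
  there. The interval is half-open to model one turn of the circle.\<close>

lemma finite_zeros_sign_polynomial:
  fixes g :: "real \<Rightarrow> real"
  assumes "continuous_on UNIV g" "finite Z"
    and "\<And>x. \<alpha> \<le> x \<Longrightarrow> x < \<beta> \<Longrightarrow> g x = 0 \<Longrightarrow> x \<in> Z"
  shows "\<exists>S \<subseteq> Z. \<exists>\<sigma>\<in>{-1, 1}. \<forall>x. \<alpha> \<le> x \<and> x < \<beta> \<longrightarrow> \<sigma> * (g x * (\<Prod>s\<in>S. x - s)) \<ge> 0"
  using assms(2,3)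
proof (induction Z arbitrary: \<beta> rule: finite_linorder_max_induct)
  case empty
  have const: "\<exists>\<sigma>\<in>{-1, 1}. \<forall>x. \<alpha> \<le> x \<and> x < \<beta> \<longrightarrow> \<sigma> * g x \<ge> 0"
  proof (rule ccontr)
    assume "\<not> ?thesis"
    then obtain x y where xy: "\<alpha> \<le> x" "x < \<beta>" "g x < 0" "\<alpha> \<le> y" "y < \<beta>" "g y > 0"
      by (auto simp: not_le)
    have "connected (g ` {\<alpha>..<\<beta>})"
      by (intro connected_continuous_image continuous_on_subset[OF assms(1)]) auto
    then have "0 \<in> g ` {\<alpha>..<\<beta>}"
      using connectedD_interval[of "g ` {\<alpha>..<\<beta>}" "g x" "g y" 0] xy by auto
    then show False using empty by auto
  qed
  then show ?case by auto
next
  case (insert s Z)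
  obtain S \<sigma> where S: "S \<subseteq> Z" "\<sigma> \<in> {-1, 1}"
    and \<sigma>: "\<And>x. \<alpha> \<le> x \<Longrightarrow> x < min s \<beta> \<Longrightarrow> \<sigma> * (g x * (\<Prod>s\<in>S. x - s)) \<ge> 0"
    using insert.IH[of "min s \<beta>"] insert.prems by fastforce
  have finS: "finite S" "s \<notin> S" using S insert.hyps finite_subset by auto
  define I where "I = {x. s < x \<and> \<alpha> \<le> x \<and> x < \<beta>}"
  have nz: "g x \<noteq> 0" if "x \<in> I" for x
    using insert.prems[of x] insert.hyps(2) that by (force simp: I_def)
  have "\<exists>\<tau>\<in>{-1, 1}. \<forall>x\<in>I. \<tau> * g x \<ge> 0"
  proof (rule ccontr)
    assume "\<not> ?thesis"
    then obtain x y where xy: "x \<in> I" "g x < 0" "y \<in> I" "g y > 0"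
      by (auto simp: not_le)
    have "connected (g ` I)"
      by (intro connected_continuous_image continuous_on_subset[OF assms(1)])
         (auto simp: I_def is_interval_1 simp flip: is_interval_connected_1)
    then have "0 \<in> g ` I"
      using connectedD_interval[of "g ` I" "g x" "g y" 0] xy by auto
    then show False using nz by auto
  qed
  then obtain \<tau> where \<tau>: "\<tau> \<in> {-1, 1}" "\<And>x. x \<in> I \<Longrightarrow> \<tau> * g x \<ge> 0" by blast
  have right: "\<tau> * (g x * (\<Prod>s\<in>S. x - s)) \<ge> 0" if "x \<in> I" for x
  proof -
    have "(\<Prod>s\<in>S. x - s) \<ge> 0"
      using that S insert.hyps(2) by (intro prod_nonneg) (fastforce simp: I_def)
    then show ?thesis using \<tau>(2)[OF that] by (metis mult.assoc mult_nonneg_nonneg)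
  qed
  have at_s: "x < min s \<beta> \<or> x \<in> I \<or> x = s"
    if "\<alpha> \<le> x" "x < \<beta>" for x
    using that by (auto simp: I_def)
  show ?case
  \<comment> \<open>\<open>\<sigma>\<close> is the sign of the corrected function to the left of
    \<open>s\<close>, \<open>\<tau>\<close> the sign to the right; \<open>s\<close> joins
    \<open>S\<close> exactly when it is a zero at which these differ.\<close>
  proof (cases "g s = 0 \<and> \<sigma> \<noteq> \<tau>")
    case True
    then have st: "\<sigma> = - \<tau>" using S \<tau> by auto
    have "\<tau> * (g x * (\<Prod>s\<in>insert s S. x - s)) \<ge> 0" if x: "\<alpha> \<le> x" "x < \<beta>" for x
    proof -
      have eq: "\<tau> * (g x * (\<Prod>s\<in>insert s S. x - s)) = (x - s) * (\<tau> * (g x * (\<Prod>s\<in>S. x - s)))"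
        using finS by simp
      consider "x < min s \<beta>" | "x \<in> I" | "x = s" using at_s[OF x] by blast
      then show ?thesis
      proof cases
        case 1
        then show ?thesis unfolding eq using \<sigma>[of x] x st
          by (intro mult_nonpos_nonpos) auto
      next
        case 2
        then show ?thesis unfolding eq
          by (intro mult_nonneg_nonneg[OF _ right]) (auto simp: I_def)
      qed (simp add: True)
    qed
    then show ?thesis using S \<tau>(1) by (intro exI[of _ "insert s S"] conjI bexI[of _ \<tau>]) auto
  next
    case False
    show ?thesis
    proof (cases "g s = 0")
      case True
      with False have "\<sigma> = \<tau>" by simp
      then have "\<sigma> * (g x * (\<Prod>s\<in>S. x - s)) \<ge> 0" if "\<alpha> \<le> x" "x < \<beta>" for x
        using at_s[OF that] \<sigma>[of x] right[of x] that True by auto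
      then show ?thesis using S by (intro exI[of _ S] conjI bexI[of _ \<sigma>]) auto
    next
      \<comment> \<open>\<open>Z\<close> is only required to contain the zeros, so \<open>s\<close>
        need not be one; it can then be discarded without shortening the interval.\<close>
      case nzs: False
      have "\<exists>S \<subseteq> Z. \<exists>\<sigma>\<in>{-1, 1}. \<forall>x. \<alpha> \<le> x \<and> x < \<beta> \<longrightarrow> \<sigma> * (g x * (\<Prod>s\<in>S. x - s)) \<ge> 0"
      proof (rule insert.IH)
        show "x \<in> Z" if "\<alpha> \<le> x" "x < \<beta>" "g x = 0" for x
          using insert.prems[OF that] that nzs by auto
      qed
      then show ?thesis
        by (elim exE conjE) (rule exI, rule conjI, erule subset_insertI2)
    qed
  qed
qed

lemma prod_cis: "(\<Prod>s\<in>S. cis (f s)) = cis (\<Sum>s\<in>S. f s)"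
  by (induction S rule: infinite_finite_induct) (simp_all add: cis_mult)

lemma cis_diff: "cis x - cis y = 2 * \<i> * of_real (sin ((x - y) / 2)) * cis ((x + y) / 2)"
proof -
  have "sin ((y - x) / 2) = - sin ((x - y) / 2)"
    by (simp flip: sin_minus add: minus_divide_left)
  then show ?thesis
    by (simp add: complex_eq_iff cos_diff_cos sin_diff_sin)
qed

lemma unit_circle_angle:
  assumes "cmod w = 1"
  obtains x where "\<alpha> \<le> x" "x < \<alpha> + 2 * pi" "w = cis x"
proof -
  define y where "y = Arg2pi (w * cis (- \<alpha>))"
  have n: "cmod (w * cis (- \<alpha>)) = 1" using assms by (simp add: norm_mult)
  have "w * cis (- \<alpha>) = cis y" "0 \<le> y" "y < 2 * pi"
    using Arg2pi[of "w * cis (- \<alpha>)"] n unfolding y_def is_Arg_def by (auto simp: cis_conv_exp)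
  moreover have "w = w * cis (- \<alpha>) * cis \<alpha>" by (simp add: cis_mult)
  ultimately show ?thesis using that[of "\<alpha> + y"] by (simp add: cis_mult add.commute)
qed

lemma inj_on_cis: "inj_on cis {\<alpha>..<\<alpha> + 2 * pi}"
proof
  fix x y assume xy: "x \<in> {\<alpha>..<\<alpha> + 2 * pi}" "y \<in> {\<alpha>..<\<alpha> + 2 * pi}" "cis x = cis y"
  have arg: "Arg2pi (cis z * cis (- \<alpha>)) = z - \<alpha>" if "z \<in> {\<alpha>..<\<alpha> + 2 * pi}" for z
    using that by (intro Arg2pi_unique[of 1]) (auto simp: cis_mult simp flip: cis_conv_exp of_real_diff)
  have "x - \<alpha> = y - \<alpha>" using arg[OF xy(1)] arg[OF xy(2)] unfolding xy(3) by (rule trans[OF sym])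
  then show "x = y" by linarith
qed

text \<open>Expressing the agreement of signs by a nonnegative factor \<open>q\<close> lets it be
  multiplied over all points of a set. At \<open>x = 0\<close> the quotient is 0 by the convention
  for division.\<close>

lemma sin_half_sign:
  assumes "\<bar>x\<bar> < 2 * pi"
  obtains q where "q \<ge> 0" "sin (x / 2) = x * q"
proof
  have "sin (x / 2) > 0" if "x > 0" using that assms by (intro sin_gt_zero) auto
  moreover have "sin (- x / 2) > 0" if "x < 0" using that assms by (intro sin_gt_zero) auto
  ultimately show "sin (x / 2) / x \<ge> 0"
    by (cases x "0 :: real" rule: linorder_cases) (auto simp: zero_le_divide_iff less_imp_le)
  show "sin (x / 2) = x * (sin (x / 2) / x)" by simp
qed

text \<open>Since $w - s = e^{ix} - e^{iy}$ is $\sin((x - y)/2)$ up to the factor $2i e^{i(x+y)/2}$, the product over an even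
  number $2m$ of points becomes real after division by $w^m$; periodicity forces the number of sign
  changes to be even.\<close>

lemma circle_sign_polynomial:
  fixes v :: "complex \<Rightarrow> real"
  assumes cont: "continuous_on UNIV v"
    and fin: "finite {w. cmod w = 1 \<and> v w = 0}" and card: "card {w. cmod w = 1 \<and> v w = 0} \<le> 2 * d"
  obtains m S c where "finite S" "card S = 2 * m" "m \<le> d" "S \<subseteq> sphere 0 1" "cmod c = 1"
    "\<And>w. cmod w = 1 \<Longrightarrow> of_real (v w) * (c * cnj w ^ m * (\<Prod>s\<in>S. w - s)) \<in> \<real>\<^sub>\<ge>\<^sub>0"
proof -
  define g where "g x = v (cis x)" for x
  have contg: "continuous_on UNIV g"
    unfolding g_def by (intro continuous_on_compose2[OF cont] continuous_intros) auto
  \<comment> \<open>The circle is cut open at a point where \<open>v\<close> is nonzero, so that no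
    sign change sits at the seam.\<close>
  have "\<exists>\<alpha>. g \<alpha> \<noteq> 0"
  proof (rule ccontr)
    assume "\<not> ?thesis"
    then have "cis ` {0..<0 + 2 * pi} \<subseteq> {w. cmod w = 1 \<and> v w = 0}" by (auto simp: g_def)
    then have "finite {0..<0 + 2 * pi}"
      using fin finite_subset finite_imageD[OF _ inj_on_cis] by blast
    then show False using infinite_Ico[of 0 "2 * pi"] pi_gt_zero by simp
  qed
  then obtain \<alpha> where \<alpha>: "g \<alpha> \<noteq> 0" by blast
  define \<beta> where "\<beta> = \<alpha> + 2 * pi"
  have "\<alpha> < \<beta>" by (simp add: \<beta>_def)
  have "g \<beta> = g \<alpha>" by (simp add: g_def \<beta>_def flip: cis_mult)
  define Z where "Z = {x. \<alpha> \<le> x \<and> x < \<beta> \<and> g x = 0}"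
  have injZ: "inj_on cis Z" by (rule inj_on_subset[OF inj_on_cis]) (auto simp: Z_def \<beta>_def)
  have sub: "cis ` Z \<subseteq> {w. cmod w = 1 \<and> v w = 0}" by (auto simp: Z_def g_def)
  have finZ: "finite Z" using sub fin finite_subset finite_imageD[OF _ injZ] by blast
  have cardZ: "card Z \<le> 2 * d"
    using card card_mono[OF fin sub] card_image[OF injZ] by simp
  obtain S0 \<sigma> where S0: "S0 \<subseteq> Z" and \<sigma>: "\<sigma> \<in> {-1, 1}"
    and sign: "\<And>x. \<alpha> \<le> x \<Longrightarrow> x < \<beta> \<Longrightarrow> \<sigma> * (g x * (\<Prod>s\<in>S0. x - s)) \<ge> 0"
  proof -
    have "\<exists>S \<subseteq> Z. \<exists>\<sigma>\<in>{-1, 1}. \<forall>x. \<alpha> \<le> x \<and> x < \<beta> \<longrightarrow> \<sigma> * (g x * (\<Prod>s\<in>S. x - s)) \<ge> 0"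
      by (rule finite_zeros_sign_polynomial[OF contg finZ]) (simp add: Z_def)
    then show ?thesis
      by (elim exE conjE bexE) (rule that, assumption+, simp)
  qed
  have finS0: "finite S0" using S0 finZ finite_subset by blast
  have S0_bounds: "\<alpha> < s" "s < \<beta>" if "s \<in> S0" for s
    using that S0 \<alpha> by (auto simp: Z_def less_le)
  have sign_\<beta>: "\<sigma> * (g \<beta> * (\<Prod>s\<in>S0. \<beta> - s)) \<ge> 0"
  proof (rule continuous_ge_on_closure[where S = "{\<alpha>..<\<beta>}" and f = "\<lambda>x. \<sigma> * (g x * (\<Prod>s\<in>S0. x - s))"])
    show "continuous_on (closure {\<alpha>..<\<beta>}) (\<lambda>x. \<sigma> * (g x * (\<Prod>s\<in>S0. x - s)))"
      by (intro continuous_intros continuous_on_subset[OF contg]) auto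
  qed (use \<open>\<alpha> < \<beta>\<close> sign in auto)
  \<comment> \<open>At \<open>\<alpha>\<close> every factor of the product is negative, at
    \<open>\<beta>\<close> every factor is positive, while \<open>g\<close> has the same nonzero
    value at both ends.\<close>
  have "even (card S0)"
  proof (rule ccontr)
    assume "odd (card S0)"
    then have "(\<Prod>s\<in>S0. \<alpha> - s) = - (\<Prod>s\<in>S0. s - \<alpha>)"
      using prod.distrib[of "\<lambda>_. -1 :: real" "\<lambda>s. s - \<alpha>" S0] by simp
    moreover have pos: "(\<Prod>s\<in>S0. s - \<alpha>) > 0" "(\<Prod>s\<in>S0. \<beta> - s) > 0"
      using S0_bounds by (auto intro!: prod_pos)
    ultimately have "(\<sigma> * g \<alpha>) * (\<Prod>s\<in>S0. s - \<alpha>) \<le> 0" "(\<sigma> * g \<alpha>) * (\<Prod>s\<in>S0. \<beta> - s) \<ge> 0"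
      using sign[of \<alpha>] sign_\<beta> \<open>\<alpha> < \<beta>\<close> \<open>g \<beta> = g \<alpha>\<close> by (auto simp: mult.assoc)
    then have "\<sigma> * g \<alpha> = 0"
      using pos by (auto simp: mult_le_0_iff zero_le_mult_iff)
    then show False using \<alpha> \<sigma> by auto
  qed
  then obtain m where m: "card S0 = 2 * m" by (rule evenE)
  \<comment> \<open>The three factors of \<open>c\<close> cancel the sign \<open>\<sigma>\<close>,
    the sign of \<open>(2 * \<i>) ^ (2 * m)\<close>, and the constant phase left over from the
    half-sums of angles.\<close>
  define c where "c = of_real \<sigma> * (-1) ^ m * cis (- (\<Sum>s\<in>S0. s) / 2)"
  have injS0: "inj_on cis S0" using injZ S0 inj_on_subset by blast
  show ?thesis
  proof (rule that[of "cis ` S0" m c])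
    show "card (cis ` S0) = 2 * m" using card_image[OF injS0] m by simp
    show "m \<le> d" using card_mono[OF finZ S0] cardZ m by simp
    show "cmod c = 1" using \<sigma> by (auto simp: c_def norm_mult norm_power)
    show "of_real (v w) * (c * cnj w ^ m * (\<Prod>s\<in>cis ` S0. w - s)) \<in> \<real>\<^sub>\<ge>\<^sub>0" if w: "cmod w = 1" for w
    proof -
      obtain x where x: "\<alpha> \<le> x" "x < \<beta>" "w = cis x"
        using unit_circle_angle[OF w, of \<alpha>] unfolding \<beta>_def by blast
      have "\<exists>q. q \<ge> 0 \<and> sin ((x - s) / 2) = (x - s) * q" if "s \<in> S0" for s
      proof -
        have "\<bar>x - s\<bar> < 2 * pi" using S0_bounds[OF that] x by (auto simp: \<beta>_def)
        then show ?thesis using sin_half_sign by metis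
      qed
      then obtain q where q: "\<And>s. s \<in> S0 \<Longrightarrow> q s \<ge> 0 \<and> sin ((x - s) / 2) = (x - s) * q s"
        by metis
      have "(\<Prod>s\<in>cis ` S0. w - s) = (\<Prod>s\<in>S0. cis x - cis s)"
        using injS0 x by (simp add: prod.reindex)
      also have "\<dots> = (\<Prod>s\<in>S0. 2 * \<i> * of_real ((x - s) * q s) * cis ((x + s) / 2))"
        using q by (intro prod.cong refl) (simp only: cis_diff)
      also have "\<dots> = (2 * \<i>) ^ (2 * m) * of_real ((\<Prod>s\<in>S0. x - s) * (\<Prod>s\<in>S0. q s)) * cis (\<Sum>s\<in>S0. (x + s) / 2)"
        by (simp add: prod.distrib m prod_cis)
      also have "(2 * \<i>) ^ (2 * m) = (-1) ^ m * of_real (4 ^ m)"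
        by (simp add: power_mult power_mult_distrib flip: power_mult_distrib)
      also have "(\<Sum>s\<in>S0. (x + s) / 2) = m * x + (\<Sum>s\<in>S0. s) / 2"
        by (simp add: sum.distrib m add_divide_distrib flip: sum_divide_distrib)
      finally have P: "(\<Prod>s\<in>cis ` S0. w - s) = (-1) ^ m * of_real (4 ^ m) *
        of_real ((\<Prod>s\<in>S0. x - s) * (\<Prod>s\<in>S0. q s)) * cis (m * x + (\<Sum>s\<in>S0. s) / 2)" .
      have "cnj w ^ m = cis (- (m * x))" by (simp add: x cis_cnj Complex.DeMoivre)
      then have cis1: "cis (- (\<Sum>s\<in>S0. s) / 2) * cnj w ^ m * cis (m * x + (\<Sum>s\<in>S0. s) / 2) = 1"
        by (simp add: cis_mult)
      have sq: "(-1) ^ m * (-1) ^ m = (1 :: complex)" by (simp flip: power_mult_distrib)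
      have "of_real (v w) * (c * cnj w ^ m * (\<Prod>s\<in>cis ` S0. w - s)) =
         of_real (g x * \<sigma> * 4 ^ m * ((\<Prod>s\<in>S0. x - s) * (\<Prod>s\<in>S0. q s))) * ((-1) ^ m * (-1) ^ m) *
         (cis (- (\<Sum>s\<in>S0. s) / 2) * cnj w ^ m * cis (m * x + (\<Sum>s\<in>S0. s) / 2))"
        unfolding P by (simp add: c_def g_def x(3) mult_ac)
      also have "\<dots> = of_real ((\<sigma> * (g x * (\<Prod>s\<in>S0. x - s))) * (4 ^ m * (\<Prod>s\<in>S0. q s)))"
        unfolding cis1 sq by (simp add: mult_ac)
      also have "\<dots> \<in> \<real>\<^sub>\<ge>\<^sub>0"
        using q by (subst nonneg_Reals_of_real_iff)
          (rule mult_nonneg_nonneg[OF sign[OF x(1,2)]], auto intro!: mult_nonneg_nonneg prod_nonneg)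
      finally show ?thesis .
    qed
  qed (use finS0 in auto)
qed

subsection \<open>Few zeros on circles\<close>

text \<open>The bounds depend only on the number of points, not on their positions, which vary with
  the radius. The constant coefficient of modulus 1 keeps the term to be isolated at full
  size.\<close>

lemma circle_polynomial_coeffs:
  fixes S :: "complex set"
  assumes "finite S" "S \<subseteq> sphere 0 1"
  defines "p \<equiv> (\<Prod>s\<in>S. [:-s, 1:])"
  shows "degree p \<le> card S" "cmod (coeff p 0) = 1" "cmod (coeff p j) \<le> 2 ^ card S"
proof -
  show "degree p \<le> card S"
    unfolding p_def using degree_prod_sum_le[OF assms(1), of "\<lambda>s. [:-s, 1:]"] by simp
  have "coeff p 0 = (\<Prod>s\<in>S. - s)"
    unfolding p_def by (simp add: poly_prod flip: poly_0_coeff_0)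
  also have "cmod \<dots> = (\<Prod>s\<in>S. 1)"
    unfolding prod_norm[symmetric] using assms(2) by (intro prod.cong) auto
  finally show "cmod (coeff p 0) = 1" by simp
  show "cmod (coeff p j) \<le> 2 ^ card S"
    unfolding p_def using assms(1,2)
  proof (induction S arbitrary: j rule: finite_induct)
    case empty
    then show ?case by (cases j) auto
  next
    case (insert s S)
    let ?q = "\<Prod>s\<in>S. [:-s, 1:]"
    have "coeff (\<Prod>s\<in>insert s S. [:-s, 1:]) j = - s * coeff ?q j + (case j of 0 \<Rightarrow> 0 | Suc i \<Rightarrow> coeff ?q i)"
      using insert.hyps by (simp add: coeff_pCons split: nat.split)
    also have "cmod \<dots> \<le> cmod (- s * coeff ?q j) + cmod (case j of 0 \<Rightarrow> 0 | Suc i \<Rightarrow> coeff ?q i)"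
      by (rule norm_triangle_ineq)
    also have "\<dots> \<le> 2 ^ card S + 2 ^ card S"
      using insert.IH insert.prems by (intro add_mono) (auto simp: norm_mult split: nat.split)
    also have "\<dots> = 2 ^ card (insert s S)" using insert.hyps by simp
    finally show ?case .
  qed
qed

lemma power_growth_eq_0:
  fixes a K R :: real
  assumes "a \<ge> 0" "M < N" and le: "\<And>r. r \<ge> R \<Longrightarrow> r \<ge> 1 \<Longrightarrow> a * r ^ N \<le> K * r ^ M"
  shows "a = 0"
proof (rule ccontr)
  assume "a \<noteq> 0"
  then have "a > 0" using assms(1) by simp
  define r where "r = max (max R 1) ((K + 1) / a)"
  have r: "r \<ge> R" "r \<ge> 1" by (auto simp: r_def)
  have "r ^ N \<ge> r ^ Suc M" using r(2) \<open>M < N\<close> by (intro power_increasing) auto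
  then have "a * (r * r ^ M) \<le> a * r ^ N" using \<open>a > 0\<close> by simp
  then have "(a * r) * r ^ M \<le> K * r ^ M" using le[OF r] by (simp add: mult.assoc)
  moreover have "r ^ M > 0" using r(2) by simp
  ultimately have "a * r \<le> K" by (simp only: mult_le_cancel_right_pos)
  moreover have "a * r \<ge> K + 1"
    using \<open>a > 0\<close> by (simp add: r_def max_def field_simps)
  ultimately show False by simp
qed

text \<open>Multiply $v = \mathrm{Re}\, G$ on the circle of radius $r$ by a real trigonometric polynomial
  $T$ of degree $m \le d$ with the sign changes of $v$, so that $vT \ge 0$. The Fourier coefficient of
  $vT$ at $N - m$ is at most its mean value, which is $O(r^d)$. Its leading term is of exact order
  $|c_N| r^N$ and all others are $O(r^{N-1})$, so $c_N = 0$.\<close>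

lemma few_zeros_imp_taylor_coeff_eq_0:
  fixes G :: "complex \<Rightarrow> complex"
  assumes hol: "G holomorphic_on UNIV"
    and fin: "\<And>r. r \<ge> R \<Longrightarrow> finite {w. cmod w = 1 \<and> Re (G (of_real r * w)) = 0}"
    and card: "\<And>r. r \<ge> R \<Longrightarrow> card {w. cmod w = 1 \<and> Re (G (of_real r * w)) = 0} \<le> 2 * d"
    and "d < N"
  shows "taylor_coeff G N = 0"
proof -
  define B where "B = (\<Sum>k\<le>N. cmod (taylor_coeff G k))"
  have "B \<ge> 0" unfolding B_def by (intro sum_nonneg) auto
  \<comment> \<open>At most \<open>2 * m + 1\<close> terms bound the mean value and
    \<open>2 * m\<close> more are moved across, each at most \<open>4 ^ d * B * r ^ (N - 1)\<close>;
    the total \<open>4 * m + 1\<close> is rounded up using \<open>m \<le> d\<close>.\<close>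
  define K where "K = (4 * d + 2) * 4 ^ d * B"
  have key: "cmod (taylor_coeff G N) / 2 * r ^ N \<le> K * r ^ (N - 1)" if r: "r \<ge> max R 1" for r
  proof -
    have "r \<ge> 1" "r > 0" using r by auto
    define V where "V = Re_Fourier G r"
    define v where "v w = Re (G (of_real r * w))" for w
    have contG: "continuous_on UNIV G" using hol by (rule holomorphic_on_imp_continuous_on)
    have contv: "continuous_on A v" for A
      unfolding v_def by (intro continuous_intros continuous_on_compose2[OF contG]) auto
    obtain m S c where S: "finite S" "card S = 2 * m" "m \<le> d" "S \<subseteq> sphere 0 1" and c: "cmod c = 1"
      and pos: "\<And>w. cmod w = 1 \<Longrightarrow> of_real (v w) * (c * cnj w ^ m * (\<Prod>s\<in>S. w - s)) \<in> \<real>\<^sub>\<ge>\<^sub>0"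
      using circle_sign_polynomial[OF contv fin[of r, folded v_def] card[of r, folded v_def]] r
      by (metis max.boundedE)
    define p where "p = (\<Prod>s\<in>S. [:-s, 1:])"
    note p = circle_polynomial_coeffs[OF S(1,4), folded p_def, unfolded S(2)]
    have p_le: "cmod (coeff p j) \<le> 4 ^ d" for j
    proof -
      have "(2 :: real) ^ (2 * m) \<le> 4 ^ d"
        using S(3) by (simp add: power_mult power_increasing)
      then show ?thesis using p(3)[of j] by linarith
    qed
    have p_sum: "(\<Prod>s\<in>S. w - s) = (\<Sum>j\<le>2*m. coeff p j * w ^ j)" for w
    proof -
      have "(\<Prod>s\<in>S. w - s) = poly p w" by (simp add: p_def poly_prod)
      also have "\<dots> = (\<Sum>j\<le>degree p. coeff p j * w ^ j)" by (rule poly_altdef)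
      also have "\<dots> = (\<Sum>j\<le>2*m. coeff p j * w ^ j)"
        using p(1) by (intro sum.mono_neutral_left) (auto simp: coeff_eq_0)
      finally show ?thesis .
    qed
    define q where "q t = of_real (v (cis (2*pi*t))) *
      (c * cnj (cis (2*pi*t)) ^ m * (\<Prod>s\<in>S. cis (2*pi*t) - s))" for t
    have q_pos: "q t \<in> \<real>\<^sub>\<ge>\<^sub>0" for t unfolding q_def by (intro pos) simp
    have V_int: "((\<lambda>t. of_real (v (cis (2*pi*t))) * cis (- (2*pi * real_of_int k * t))) has_integral V k) {0..1}" for k
      unfolding V_def Re_Fourier_def v_def
      by (intro integrable_integral integrable_continuous_real continuous_intros
          continuous_on_compose2[OF contG]) auto
    \<comment> \<open>The factor \<open>cnj w ^ m * w ^ j\<close> on the unit circle shifts the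
      frequency by \<open>m - j\<close>.\<close>
    have q_int: "((\<lambda>t. q t * cis (- (2*pi * real_of_int k * t))) has_integral
        c * (\<Sum>j\<le>2*m. coeff p j * V (k + int m - int j))) {0..1}" for k
    proof -
      have "((\<lambda>t. c * (\<Sum>j\<le>2*m. coeff p j * (of_real (v (cis (2*pi*t))) *
            cis (- (2*pi * real_of_int (k + int m - int j) * t)))))
          has_integral c * (\<Sum>j\<le>2*m. coeff p j * V (k + int m - int j))) {0..1}"
        by (intro has_integral_mult_right has_integral_sum V_int) simp
      moreover have "c * (\<Sum>j\<le>2*m. coeff p j * (of_real (v (cis (2*pi*t))) *
            cis (- (2*pi * real_of_int (k + int m - int j) * t)))) = q t * cis (- (2*pi * real_of_int k * t))" for t
      proof -
        have shift: "cnj (cis (2*pi*t)) ^ m * cis (2*pi*t) ^ j * cis (- (2*pi * real_of_int k * t))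
           = cis (- (2*pi * real_of_int (k + int m - int j) * t))" for j
          by (simp add: cis_cnj Complex.DeMoivre cis_mult algebra_simps)
        have "q t * cis (- (2*pi * real_of_int k * t)) =
            c * (\<Sum>j\<le>2*m. coeff p j * (of_real (v (cis (2*pi*t))) *
              (cnj (cis (2*pi*t)) ^ m * cis (2*pi*t) ^ j * cis (- (2*pi * real_of_int k * t)))))"
          unfolding q_def p_sum sum_distrib_left sum_distrib_right
          by (rule sum.cong[OF refl]) (simp only: mult_ac)
        then show ?thesis unfolding shift by (rule sym)
      qed
      ultimately show ?thesis by simp
    qed
    define I where "I k = c * (\<Sum>j\<le>2*m. coeff p j * V (k + int m - int j))" for k
    \<comment> \<open>For a nonnegative function no Fourier coefficient exceeds the mean in
      modulus.\<close>
    have I_le: "cmod (I k) \<le> cmod (I 0)" for k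
    proof -
      have q0: "(q has_integral I 0) {0..1}" using q_int[of 0] by (simp add: I_def)
      have "cmod (integral {0..1} (\<lambda>t. q t * cis (- (2*pi * real_of_int k * t)))) \<le> integral {0..1} (\<lambda>t. Re (q t))"
      proof (rule integral_norm_bound_integral)
        show "(\<lambda>t. q t * cis (- (2*pi * real_of_int k * t))) integrable_on {0..1}"
          using q_int[of k] by blast
        show "(\<lambda>t. Re (q t)) integrable_on {0..1}"
          using has_integral_Re[OF q0] by blast
        show "cmod (q t * cis (- (2*pi * real_of_int k * t))) \<le> Re (q t)" for t
          using q_pos[of t] by (auto simp: norm_mult elim: nonneg_Reals_cases)
      qed
      also have "integral {0..1} (\<lambda>t. Re (q t)) = Re (I 0)"
        using has_integral_Re[OF q0] by (rule integral_unique)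
      also have "\<dots> \<le> cmod (I 0)" by (rule complex_Re_le_cmod)
      finally show ?thesis using integral_unique[OF q_int[of k]] by (simp add: I_def)
    qed
    have V_le: "cmod (V k) \<le> B * r ^ (N - 1)" if "\<bar>k\<bar> \<le> int N - 1" for k
    proof -
      have "cmod (V k) \<le> cmod (taylor_coeff G (nat \<bar>k\<bar>)) * r ^ nat \<bar>k\<bar>"
        unfolding V_def by (rule norm_Re_Fourier_le[OF hol \<open>r > 0\<close>])
      also have "\<dots> \<le> B * r ^ (N - 1)"
        unfolding B_def using that \<open>r \<ge> 1\<close> \<open>d < N\<close>
        by (intro mult_mono power_increasing member_le_sum sum_nonneg) auto
      finally show ?thesis .
    qed
    have term_le: "cmod (coeff p j * V k) \<le> 4 ^ d * (B * r ^ (N - 1))" if "\<bar>k\<bar> \<le> int N - 1" for j k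
      unfolding norm_mult using p_le V_le[OF that] by (intro mult_mono) auto
    let ?M = "4 ^ d * (B * r ^ (N - 1))"
    have "cmod (I 0) \<le> (\<Sum>j\<le>2*m. cmod (coeff p j * V (int m - int j)))"
      using norm_sum[of "\<lambda>j. coeff p j * V (int m - int j)" "{..2*m}"] by (simp add: I_def norm_mult c)
    also have "\<dots> \<le> (\<Sum>j\<le>2*m. ?M)"
      using S(3) \<open>d < N\<close> by (intro sum_mono term_le) auto
    finally have I0: "cmod (I 0) \<le> (2 * m + 1) * ?M" by simp
    \<comment> \<open>This frequency places \<open>V (int N)\<close> at \<open>j = 0\<close>. The
      other indices run from \<open>N - 2 * m\<close> to \<open>N - 1\<close>, and since
      \<open>m \<le> d < N\<close> their absolute values stay below \<open>N\<close>.\<close>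
    have "I (int N - int m) = c * (\<Sum>j\<le>2*m. coeff p j * V (int N - int j))"
      by (simp add: I_def)
    also have "(\<Sum>j\<le>2*m. coeff p j * V (int N - int j)) =
        coeff p 0 * V (int N) + (\<Sum>j\<in>{1..2*m}. coeff p j * V (int N - int j))"
      by (subst sum.remove[of _ 0]) (auto intro!: sum.cong)
    finally have "coeff p 0 * V (int N) = I (int N - int m) / c - (\<Sum>j\<in>{1..2*m}. coeff p j * V (int N - int j))"
      using c by (auto simp: eq_diff_eq)
    then have V0: "cmod (coeff p 0 * V (int N)) = cmod (I (int N - int m) / c - (\<Sum>j\<in>{1..2*m}. coeff p j * V (int N - int j)))"
      by (rule arg_cong)
    have "cmod (V (int N)) = cmod (I (int N - int m) / c - (\<Sum>j\<in>{1..2*m}. coeff p j * V (int N - int j)))"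
      using V0 unfolding norm_mult p(2) by (simp only: mult_1)
    also have "\<dots> \<le> cmod (I (int N - int m) / c) + cmod (\<Sum>j\<in>{1..2*m}. coeff p j * V (int N - int j))"
      by (rule norm_triangle_ineq4)
    also have "\<dots> \<le> (2 * m + 1) * ?M + (\<Sum>j\<in>{1..2*m}. ?M)"
    proof (rule add_mono)
      show "cmod (I (int N - int m) / c) \<le> (2 * m + 1) * ?M"
        using I_le[of "int N - int m"] I0 c by (simp add: norm_divide)
      show "cmod (\<Sum>j\<in>{1..2*m}. coeff p j * V (int N - int j)) \<le> (\<Sum>j\<in>{1..2*m}. ?M)"
        using S(3) \<open>d < N\<close> by (intro sum_norm_le term_le) auto
    qed
    also have "\<dots> = (4 * m + 1) * ?M" by (simp add: algebra_simps)
    also have "\<dots> \<le> (4 * d + 2) * ?M"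
      using S(3) \<open>B \<ge> 0\<close> \<open>r > 0\<close> by (intro mult_right_mono) auto
    also have "\<dots> = K * r ^ (N - 1)" by (simp add: K_def algebra_simps)
    finally have "cmod (V (int N)) \<le> K * r ^ (N - 1)" .
    moreover have "V (int N) = taylor_coeff G N * of_real r ^ N / 2"
      unfolding V_def using \<open>d < N\<close> by (intro Re_Fourier_pos[OF hol \<open>r > 0\<close>]) simp
    ultimately show ?thesis
      using \<open>r > 0\<close> by (simp add: norm_mult norm_divide norm_power)
  qed
  have "cmod (taylor_coeff G N) / 2 = 0"
  proof (rule power_growth_eq_0)
    show "N - 1 < N" using \<open>d < N\<close> by simp
    show "cmod (taylor_coeff G N) / 2 * r ^ N \<le> K * r ^ (N - 1)" if "r \<ge> R" "r \<ge> 1" for r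
      using that by (intro key) simp
  qed simp
  then show ?thesis by simp
qed

subsection \<open>Polynomials\<close>

lemma entire_finite_taylor:
  assumes "G holomorphic_on UNIV" "\<And>k. k > n \<Longrightarrow> taylor_coeff G k = 0"
  shows "G z = (\<Sum>k\<le>n. taylor_coeff G k * z ^ k)"
proof -
  have "(\<lambda>k. taylor_coeff G k * z ^ k) sums G z"
    using holomorphic_power_series[of G 0 "cmod z + 1" z] assms(1)
    by (auto simp: taylor_coeff_def intro: holomorphic_on_subset)
  moreover have "(\<lambda>k. taylor_coeff G k * z ^ k) sums (\<Sum>k\<le>n. taylor_coeff G k * z ^ k)"
    using assms(2) by (intro sums_finite) (auto simp: not_le)
  ultimately show ?thesis by (rule sums_unique2)
qed

text \<open>On the unit circle the conjugate of \<open>w\<close> is 1/w, so 2 w^n times the real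
  part is a polynomial \<open>p\<close> in \<open>w\<close> of degree at most \<open>2 * n\<close>.
  For \<open>n = 0\<close> the two contributions merge into \<open>2 * Re (a 0)\<close>, hence the
  separate alternative in the hypothesis.\<close>

lemma Re_polynomial_circle_zeros:
  fixes a :: "nat \<Rightarrow> complex"
  assumes nz: "n > 0 \<and> a n \<noteq> 0 \<or> n = 0 \<and> Re (a 0) \<noteq> 0" and "r > 0"
  defines "Z \<equiv> {w. cmod w = 1 \<and> Re (\<Sum>k\<le>n. a k * (of_real r * w) ^ k) = 0}"
  shows "finite Z" "card Z \<le> 2 * n"
proof -
  define p where "p = (\<Sum>k\<le>n. monom (a k * of_real r ^ k) (n + k) + monom (cnj (a k) * of_real r ^ k) (n - k))"
  have "degree p \<le> 2 * n"
    unfolding p_def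
    by (intro degree_sum_le degree_add_le order.trans[OF degree_monom_le]) auto
  have "p \<noteq> 0"
  proof -
    have "coeff p (2 * n) = (\<Sum>k\<le>n. (if k = n then a k * of_real r ^ k else 0)
        + (if k = 0 \<and> n = 0 then cnj (a k) * of_real r ^ k else 0))"
      unfolding p_def coeff_sum by (intro sum.cong) auto
    also have "\<dots> = a n * of_real r ^ n + (if n = 0 then cnj (a 0) else 0)"
      unfolding sum.distrib by (auto simp: sum.delta)
    also have "\<dots> \<noteq> 0"
      using nz \<open>r > 0\<close> by (auto simp: complex_eq_iff)
    finally show ?thesis by auto
  qed
  have "Z \<subseteq> {w. poly p w = 0}"
  proof
    fix w assume w: "w \<in> Z"
    then have n1: "w * cnj w = 1" by (simp add: Z_def complex_norm_square[symmetric])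
    define S where "S = (\<Sum>k\<le>n. a k * (of_real r * w) ^ k)"
    have "poly p w = (\<Sum>k\<le>n. w ^ n * (a k * (of_real r * w) ^ k + cnj (a k * (of_real r * w) ^ k)))"
      unfolding p_def poly_sum
    proof (rule sum.cong[OF refl])
      fix k assume "k \<in> {..n}"
      then have "w ^ n = w ^ (n - k) * w ^ k" by (simp flip: power_add)
      then have "w ^ n * cnj w ^ k = w ^ (n - k) * (w * cnj w) ^ k"
        by (simp add: power_mult_distrib)
      then have "w ^ n * cnj w ^ k = w ^ (n - k)" by (simp add: n1)
      then show "poly (monom (a k * of_real r ^ k) (n + k) + monom (cnj (a k) * of_real r ^ k) (n - k)) w
          = w ^ n * (a k * (of_real r * w) ^ k + cnj (a k * (of_real r * w) ^ k))"
        by (simp add: poly_monom power_mult_distrib power_add algebra_simps)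
    qed
    also have "\<dots> = w ^ n * (S + cnj S)"
      unfolding S_def cnj_sum by (simp only: flip: sum_distrib_left sum.distrib)
    finally have p_w: "poly p w = w ^ n * (S + cnj S)" .
    have "Re S = 0"
      using w by (simp only: Z_def S_def mem_Collect_eq)
    then have "S + cnj S = 0" by (simp add: complex_add_cnj)
    then show "w \<in> {w. poly p w = 0}" using p_w by simp
  qed
  moreover have "finite {w. poly p w = 0}" "card {w. poly p w = 0} \<le> degree p"
    using \<open>p \<noteq> 0\<close> by (auto intro: poly_roots_finite card_poly_roots_bound)
  ultimately show "finite Z" "card Z \<le> 2 * n"
    using \<open>degree p \<le> 2 * n\<close> finite_subset card_mono[of "{w. poly p w = 0}" Z] by auto
qed

lemma Re_polynomial_normalize:
  fixes h :: "nat \<Rightarrow> complex"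
  obtains m where "m \<le> n" "m = 0 \<or> h m \<noteq> 0"
    "\<And>z. (\<Sum>k\<le>n. h k * z ^ k) = (\<Sum>k\<le>m. h k * z ^ k)"
proof (induction n arbitrary: thesis)
  case 0
  then show ?case by auto
next
  case (Suc n)
  show ?case
  proof (cases "h (Suc n) = 0")
    case True
    obtain m where "m \<le> n" "m = 0 \<or> h m \<noteq> 0" "\<And>z. (\<Sum>k\<le>n. h k * z ^ k) = (\<Sum>k\<le>m. h k * z ^ k)"
      using Suc.IH by blast
    then show ?thesis using True by (intro Suc.prems[of m]) auto
  next
    case False
    then show ?thesis by (intro Suc.prems[of "Suc n"]) auto
  qed
qed

text \<open>Both exponents in \<open>poly_C\<close> go up to the same \<open>n\<close>, so the total
  degree can reach twice that number.\<close>

lemma poly_C_bound: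
  assumes "poly_C u"
  obtains n K where "\<And>z. cmod z \<ge> 1 \<Longrightarrow> \<bar>u z\<bar> \<le> K * cmod z ^ n"
proof -
  obtain n c where u: "\<And>z. u z = (\<Sum>i\<le>n. \<Sum>j\<le>n. c i j * Re z ^ i * Im z ^ j)"
    using assms unfolding poly_C_def by blast
  have "\<bar>u z\<bar> \<le> (\<Sum>i\<le>n. \<Sum>j\<le>n. \<bar>c i j\<bar>) * cmod z ^ (2 * n)" if "cmod z \<ge> 1" for z
  proof -
    have "\<bar>u z\<bar> \<le> (\<Sum>i\<le>n. \<Sum>j\<le>n. \<bar>c i j * Re z ^ i * Im z ^ j\<bar>)"
      unfolding u by (intro order.trans[OF sum_abs] sum_mono sum_abs)
    also have "\<dots> \<le> (\<Sum>i\<le>n. \<Sum>j\<le>n. \<bar>c i j\<bar> * cmod z ^ (2 * n))"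
    proof (intro sum_mono)
      fix i j assume ij: "i \<in> {..n}" "j \<in> {..n}"
      have "\<bar>Re z\<bar> ^ i * \<bar>Im z\<bar> ^ j \<le> cmod z ^ i * cmod z ^ j"
        by (intro mult_mono power_mono abs_Re_le_cmod abs_Im_le_cmod) auto
      also have "\<dots> = cmod z ^ (i + j)" by (simp add: power_add)
      also have "\<dots> \<le> cmod z ^ (2 * n)" using that ij by (intro power_increasing) auto
      finally have "\<bar>c i j\<bar> * (\<bar>Re z\<bar> ^ i * \<bar>Im z\<bar> ^ j) \<le> \<bar>c i j\<bar> * cmod z ^ (2 * n)"
        by (intro mult_left_mono) auto
      then show "\<bar>c i j * Re z ^ i * Im z ^ j\<bar> \<le> \<bar>c i j\<bar> * cmod z ^ (2 * n)"
        by (simp add: abs_mult power_abs mult.assoc)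
    qed
    also have "\<dots> = (\<Sum>i\<le>n. \<Sum>j\<le>n. \<bar>c i j\<bar>) * cmod z ^ (2 * n)"
      by (simp only: sum_distrib_right)
    finally show ?thesis .
  qed
  then show ?thesis by (rule that)
qed

text \<open>The Fourier coefficient at \<open>k\<close> has modulus of exact order r^k unless the
  Taylor coefficient is 0, while the bound allows only r^n. This passes from a polynomial
  \<open>u\<close> to a polynomial \<open>F\<close>.\<close>

lemma polynomial_growth_taylor_coeff_eq_0:
  assumes hol: "G holomorphic_on UNIV"
    and bound: "\<And>z. cmod z \<ge> 1 \<Longrightarrow> \<bar>Re (G z)\<bar> \<le> K * cmod z ^ n"
    and "n < k"
  shows "taylor_coeff G k = 0"
proof -
  have "cmod (taylor_coeff G k) / 2 = 0"
  proof (rule power_growth_eq_0[OF _ \<open>n < k\<close>])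
    fix r :: real assume r: "r \<ge> 1"
    have contG: "continuous_on UNIV G" using hol by (rule holomorphic_on_imp_continuous_on)
    have "cmod (Re_Fourier G r (int k)) \<le> integral {0..1} (\<lambda>t::real. K * r ^ n)"
      unfolding Re_Fourier_def
    proof (rule integral_norm_bound_integral)
      show "(\<lambda>t. of_real (Re (G (of_real r * cis (2*pi*t)))) * cis (- (2*pi * real_of_int (int k) * t))) integrable_on {0..1}"
        by (intro integrable_continuous_real continuous_intros continuous_on_compose2[OF contG]) auto
      show "cmod (of_real (Re (G (of_real r * cis (2*pi*t)))) * cis (- (2*pi * real_of_int (int k) * t))) \<le> K * r ^ n" for t
        using bound[of "of_real r * cis (2*pi*t)"] r by (simp add: norm_mult)
    qed auto
    then show "cmod (taylor_coeff G k) / 2 * r ^ k \<le> K * r ^ n"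
      using r \<open>n < k\<close> by (subst (asm) Re_Fourier_pos[OF hol]) (auto simp: norm_mult norm_divide norm_power)
  qed simp
  then show ?thesis by simp
qed

lemma polynomial_ray_tendsto:
  fixes a :: "nat \<Rightarrow> complex"
  shows "((\<lambda>r. Re (\<Sum>k\<le>n. a k * (of_real r * w) ^ k) / r ^ n) \<longlongrightarrow> Re (a n * w ^ n)) at_top"
proof -
  have lim: "((\<lambda>r::real. r ^ k / r ^ n) \<longlongrightarrow> (if k = n then 1 else 0)) at_top" if "k \<le> n" for k
  proof (cases "k = n")
    case True
    have "eventually (\<lambda>r::real. 1 = r ^ k / r ^ n) at_top"
      by (rule eventually_mono[OF eventually_gt_at_top[of 0]]) (simp add: True)
    then show ?thesis using True by (auto intro: Lim_transform_eventually)
  next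
    case False
    have "((\<lambda>r::real. 1 / r ^ (n - k)) \<longlongrightarrow> 0) at_top"
      using False that
      by (intro tendsto_divide_0[OF tendsto_const] filterlim_at_top_imp_at_infinity filterlim_pow_at_top filterlim_ident) auto
    moreover have "eventually (\<lambda>r::real. 1 / r ^ (n - k) = r ^ k / r ^ n) at_top"
      by (rule eventually_mono[OF eventually_gt_at_top[of 0]]) (use that in \<open>simp add: power_diff\<close>)
    ultimately show ?thesis using False by (auto intro: Lim_transform_eventually)
  qed
  have "((\<lambda>r. \<Sum>k\<le>n. Re (a k * w ^ k) * (r ^ k / r ^ n)) \<longlongrightarrow>
      (\<Sum>k\<le>n. Re (a k * w ^ k) * (if k = n then 1 else 0))) at_top"
    by (intro tendsto_sum tendsto_mult tendsto_const lim) auto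
  moreover have "(\<Sum>k\<le>n. Re (a k * w ^ k) * (if k = n then 1 else 0)) = Re (a n * w ^ n)"
    by (simp add: if_distrib sum.delta cong: if_cong)
  moreover have "(\<Sum>k\<le>n. Re (a k * w ^ k) * (r ^ k / r ^ n)) = Re (\<Sum>k\<le>n. a k * (of_real r * w) ^ k) / r ^ n" for r
  proof -
    have "Re (a k * (of_real r * w) ^ k) = Re (a k * w ^ k) * r ^ k" for k
    proof -
      have "a k * (of_real r * w) ^ k = r ^ k *\<^sub>R (a k * w ^ k)"
        by (simp add: power_mult_distrib scaleR_conv_of_real)
      then show ?thesis by (simp only: scaleR_complex.sel mult.commute)
    qed
    then show ?thesis by (simp add: sum_divide_distrib)
  qed
  ultimately show ?thesis by simp
qed

lemma poly_C_scale:
  assumes "poly_C u"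
  shows "poly_C (\<lambda>z. c * u z)"
proof -
  obtain n d where u: "\<And>z. u z = (\<Sum>i\<le>n. \<Sum>j\<le>n. d i j * Re z ^ i * Im z ^ j)"
    using assms unfolding poly_C_def by blast
  have "c * u z = (\<Sum>i\<le>n. \<Sum>j\<le>n. (c * d i j) * Re z ^ i * Im z ^ j)" for z
    by (simp only: u sum_distrib_left mult.assoc)
  then show ?thesis
    unfolding poly_C_def by (intro exI[of _ n] exI[of _ "\<lambda>i j. c * d i j"] allI)
qed

lemma unit_circle_root:
  assumes "cmod w = 1" "n > 0"
  obtains x where "cmod x = 1" "x ^ n = w"
proof -
  obtain \<theta> where "w = cis \<theta>" using unit_circle_angle[OF assms(1), of 0] by blast
  then show ?thesis using assms(2) by (intro that[of "cis (\<theta> / n)"]) (auto simp: Complex.DeMoivre)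
qed

text \<open>Rotating \<open>B\<close> onto the imaginary axis kills its real part, so the same
  rotation must kill that of \<open>A\<close>; thus \<open>A\<close> is a real multiple of
  \<open>B\<close>. Rotating \<open>B\<close> onto the positive real axis then bounds the
  factor.\<close>

lemma Re_rotations_dominated:
  fixes A B :: complex
  assumes le: "\<And>w. cmod w = 1 \<Longrightarrow> \<bar>Re (A * w)\<bar> \<le> a * \<bar>Re (B * w)\<bar>" and "A \<noteq> 0"
  obtains b where "B \<noteq> 0" "\<bar>b\<bar> \<le> a" "A = of_real b * B"
proof -
  define dir where "dir C = cnj C / of_real (cmod C)" for C :: complex
  have dir: "C * dir C = of_real (cmod C)" "cmod (dir C) = 1" if "C \<noteq> 0" for C
    using that by (auto simp: dir_def norm_divide complex_norm_square[symmetric] power2_eq_square field_simps)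
  have "B \<noteq> 0"
  proof
    assume "B = 0"
    then show False using le[of "dir A"] dir[OF \<open>A \<noteq> 0\<close>] \<open>A \<noteq> 0\<close> by simp
  qed
  note dirB = dir[OF this]
  have "Re (B * (\<i> * dir B)) = 0"
    using arg_cong[OF dirB(1), of "\<lambda>z. Re (\<i> * z)"] by (simp add: algebra_simps)
  then have "Re (A * (\<i> * dir B)) = 0"
    using le[of "\<i> * dir B"] dirB(2) by (simp add: norm_mult)
  then have "Im (A * dir B) = 0" by (simp add: algebra_simps)
  then have AB: "A * dir B = of_real (Re (A * dir B))" by (simp add: complex_eq_iff)
  define b where "b = Re (A * dir B) / cmod B"
  have "A * dir B = of_real b * B * dir B"
    using AB dirB(1) \<open>B \<noteq> 0\<close> by (simp add: b_def mult.assoc)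
  moreover have "dir B \<noteq> 0" using dirB(2) by auto
  ultimately have A: "A = of_real b * B" by simp
  have "\<bar>b\<bar> * cmod B \<le> a * cmod B"
    using le[OF dirB(2)] unfolding A mult.assoc dirB(1) by (simp add: abs_mult)
  then have "\<bar>b\<bar> \<le> a" using \<open>B \<noteq> 0\<close> by simp
  then show ?thesis using that \<open>B \<noteq> 0\<close> A by blast
qed

theorem theorem3:
  fixes u v :: "complex \<Rightarrow> real" and a R :: real
  assumes "harmonic_C u" and "harmonic_C v"
    and "poly_C u" and "\<not> (\<exists>c. \<forall>z. u z = c)"
    and "a > 0" and "R > 0"
    and "\<forall>z. cmod z \<ge> R \<longrightarrow> \<bar>u z\<bar> \<le> a * \<bar>v z\<bar>"
  shows "\<exists>b::real. \<bar>b\<bar> \<le> a \<and> (\<forall>z. u z = b * v z) \<and> poly_C v \<and>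
           (\<lambda>z. complex_of_real (u z) + \<i> * complex_of_real (v z)) ` UNIV
             = {complex_of_real t * (complex_of_real b + \<i>) | t. True}"
proof -
  obtain F where F: "F holomorphic_on UNIV" and uF: "\<And>z. u z = Re (F z)"
    using harmonic_C_Re_holomorphic[OF assms(1)] by blast
  obtain G where G: "G holomorphic_on UNIV" and vG: "\<And>z. v z = Re (G z)"
    using harmonic_C_Re_holomorphic[OF assms(2)] by blast
  define f where "f = taylor_coeff F"
  define g where "g = taylor_coeff G"
  obtain n0 K where "\<And>z. cmod z \<ge> 1 \<Longrightarrow> \<bar>u z\<bar> \<le> K * cmod z ^ n0"
    using poly_C_bound[OF assms(3)] by blast
  then have "taylor_coeff F k = 0" if "k > n0" for k
    using that unfolding uF by (rule polynomial_growth_taylor_coeff_eq_0[OF F])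
  then have F0: "F z = (\<Sum>k\<le>n0. f k * z ^ k)" for z
    unfolding f_def by (rule entire_finite_taylor[OF F])
  obtain n where n: "n = 0 \<or> f n \<noteq> 0"
    and "\<And>z. (\<Sum>k\<le>n0. f k * z ^ k) = (\<Sum>k\<le>n. f k * z ^ k)"
    using Re_polynomial_normalize[of n0 f] by blast
  then have Fn: "F z = (\<Sum>k\<le>n. f k * z ^ k)" for z
    unfolding F0 by simp
  have "n > 0"
  proof (rule ccontr)
    assume "\<not> n > 0"
    then have "u z = Re (f 0)" for z by (simp add: uF Fn)
    then show False using assms(4) by blast
  qed
  with n have fn: "f n \<noteq> 0" by simp
  have norm_r: "cmod (of_real r * w) \<ge> R" if "r \<ge> R" "cmod w = 1" for r w
    using that assms(6) by (simp add: norm_mult)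
  have dominated_zero: "u z = 0" if "cmod z \<ge> R" "v z = 0" for z
    using assms(7) that by force
  have uZ: "finite {w. cmod w = 1 \<and> u (of_real r * w) = 0}" "card {w. cmod w = 1 \<and> u (of_real r * w) = 0} \<le> 2 * n"
    if "r \<ge> R" for r
    using Re_polynomial_circle_zeros[of n f r] fn \<open>n > 0\<close> that assms(6) unfolding uF Fn by auto
  have vZ_sub: "{w. cmod w = 1 \<and> Re (G (of_real r * w)) = 0} \<subseteq> {w. cmod w = 1 \<and> u (of_real r * w) = 0}"
    if "r \<ge> R" for r
    using dominated_zero norm_r[OF that] by (auto simp flip: vG)
  have "taylor_coeff G k = 0" if "k > n" for k
    using few_zeros_imp_taylor_coeff_eq_0[OF G, of R n k] that uZ vZ_sub
    by (meson card_mono finite_subset order_trans)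
  then have Gn: "G z = (\<Sum>k\<le>n. g k * z ^ k)" for z
    unfolding g_def by (rule entire_finite_taylor[OF G])
  \<comment> \<open>Along the ray through \<open>x\<close>, division by \<open>r ^ n\<close> leaves
    the top terms at \<open>x ^ n\<close> in the limit. Every unit \<open>w\<close> is such a power
    because \<open>n > 0\<close>. At this point \<open>g n\<close> might still be 0.\<close>
  have lead: "\<bar>Re (f n * w)\<bar> \<le> a * \<bar>Re (g n * w)\<bar>" if w: "cmod w = 1" for w
  proof -
    obtain x where x: "cmod x = 1" "x ^ n = w" using unit_circle_root[OF w \<open>n > 0\<close>] by blast
    have "((\<lambda>r. \<bar>u (of_real r * x) / r ^ n\<bar>) \<longlongrightarrow> \<bar>Re (f n * x ^ n)\<bar>) at_top"
      unfolding uF Fn by (intro tendsto_rabs polynomial_ray_tendsto)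
    moreover have "((\<lambda>r. a * \<bar>v (of_real r * x) / r ^ n\<bar>) \<longlongrightarrow> a * \<bar>Re (g n * x ^ n)\<bar>) at_top"
      unfolding vG Gn by (intro tendsto_mult tendsto_const tendsto_rabs polynomial_ray_tendsto)
    moreover have "\<bar>u (of_real r * x) / r ^ n\<bar> \<le> a * \<bar>v (of_real r * x) / r ^ n\<bar>" if "r \<ge> R" for r
      using assms(6,7) norm_r[OF that x(1)] that
      by (simp add: abs_divide power_abs divide_right_mono)
    then have "eventually (\<lambda>r. \<bar>u (of_real r * x) / r ^ n\<bar> \<le> a * \<bar>v (of_real r * x) / r ^ n\<bar>) at_top"
      by (rule eventually_mono[OF eventually_ge_at_top])
    ultimately show ?thesis
      unfolding x(2) by (intro tendsto_le[OF _ _ _]) auto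
  qed
  text \<open>Hence $u - bv$ has degree below $n$ and vanishes wherever $v$ does outside the disc; unless it is
    zero, $v$ has too few zeros on large circles for $g_n \ne 0$.\<close>
  obtain b where gn: "g n \<noteq> 0" and b: "\<bar>b\<bar> \<le> a" and fg: "f n = of_real b * g n"
    using Re_rotations_dominated[OF lead fn] by blast
  define h where "h k = f k - of_real b * g k" for k
  have w_eq: "u z - b * v z = Re (\<Sum>k\<le>n. h k * z ^ k)" for z
  proof -
    have "(\<Sum>k\<le>n. h k * z ^ k) = F z - of_real b * G z"
      unfolding Fn Gn h_def by (simp add: left_diff_distrib sum_subtractf sum_distrib_left mult.assoc)
    then show ?thesis by (simp add: uF vG)
  qed
  obtain m where m: "m \<le> n" "m = 0 \<or> h m \<noteq> 0" "\<And>z. (\<Sum>k\<le>n. h k * z ^ k) = (\<Sum>k\<le>m. h k * z ^ k)"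
    using Re_polynomial_normalize[of n h] by blast
  \<comment> \<open>The choice of \<open>b\<close> makes \<open>h n = 0\<close>, whereas
    \<open>m = n > 0\<close> would require \<open>h m \<noteq> 0\<close>.\<close>
  have "m \<noteq> n" using m(2) \<open>n > 0\<close> fg by (auto simp: h_def)
  \<comment> \<open>Only the real part of \<open>h 0\<close> can be shown to vanish, since
    \<open>F\<close> and \<open>G\<close> are determined only up to imaginary constants.\<close>
  have "m = 0 \<and> Re (h 0) = 0"
  proof (rule ccontr)
    assume nz: "\<not> (m = 0 \<and> Re (h 0) = 0)"
    have nz': "m > 0 \<and> h m \<noteq> 0 \<or> m = 0 \<and> Re (h 0) \<noteq> 0" using nz m(2) by auto
    have wZ: "finite {w. cmod w = 1 \<and> u (of_real r * w) - b * v (of_real r * w) = 0}"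
      "card {w. cmod w = 1 \<and> u (of_real r * w) - b * v (of_real r * w) = 0} \<le> 2 * (n - 1)"
      if "r \<ge> R" for r
    proof -
      have "r > 0" "2 * m \<le> 2 * (n - 1)" using that assms(6) m(1) \<open>m \<noteq> n\<close> by auto
      then show "finite {w. cmod w = 1 \<and> u (of_real r * w) - b * v (of_real r * w) = 0}"
        "card {w. cmod w = 1 \<and> u (of_real r * w) - b * v (of_real r * w) = 0} \<le> 2 * (n - 1)"
        using Re_polynomial_circle_zeros[OF nz', of r] unfolding w_eq m(3) by (blast, linarith)
    qed
    have "{w. cmod w = 1 \<and> Re (G (of_real r * w)) = 0} \<subseteq>
        {w. cmod w = 1 \<and> u (of_real r * w) - b * v (of_real r * w) = 0}" if "r \<ge> R" for r
      using dominated_zero norm_r[OF that] by (auto simp flip: vG)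
    with wZ have "taylor_coeff G n = 0"
      using few_zeros_imp_taylor_coeff_eq_0[OF G, of R "n - 1" n] \<open>n > 0\<close>
      by (meson card_mono finite_subset order_trans diff_less zero_less_one)
    then show False using gn by (simp add: g_def)
  qed
  then have uv: "u z = b * v z" for z
    using w_eq[of z] m(3)[of z] by simp
  have "b \<noteq> 0" using assms(4) uv by auto
  have "poly_C v"
    using poly_C_scale[OF assms(3), of "1 / b"] \<open>b \<noteq> 0\<close> by (simp add: uv)
  text \<open>An omitted value $t$ would make $v - t$ zero-free on all circles, hence constant.\<close>
  have surj: "\<exists>z. v z = t" for t
  proof (rule ccontr)
    assume "\<nexists>z. v z = t"
    then have empty: "{w. cmod w = 1 \<and> Re (G (of_real r * w) - of_real t) = 0} = {}" for r
      by (auto simp: vG)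
    have "taylor_coeff (\<lambda>z. G z - of_real t) n = 0"
    proof (rule few_zeros_imp_taylor_coeff_eq_0[where d = 0])
      show "(\<lambda>z. G z - of_real t) holomorphic_on UNIV" by (intro holomorphic_intros G)
    qed (use \<open>n > 0\<close> in \<open>simp_all only: empty finite.emptyI card.empty\<close>)
    moreover have "taylor_coeff (\<lambda>z. G z - of_real t) n = g n"
      using \<open>n > 0\<close> higher_deriv_diff[OF G holomorphic_on_const open_UNIV UNIV_I, of n "of_real t" 0]
      by (simp add: taylor_coeff_def g_def)
    ultimately show False using gn by simp
  qed
  \<comment> \<open>By \<open>u = b v\<close> each value of f is \<open>v z\<close> times
    \<open>b + \<i>\<close>, so the image is governed by the range of \<open>v\<close>
    alone.\<close>
  have "(\<lambda>z. complex_of_real (u z) + \<i> * complex_of_real (v z)) ` UNIV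
      = (\<lambda>t. complex_of_real t * (complex_of_real b + \<i>)) ` range v"
    by (simp add: image_image uv algebra_simps)
  also have "range v = UNIV" using surj by (metis surj_def)
  finally have "(\<lambda>z. complex_of_real (u z) + \<i> * complex_of_real (v z)) ` UNIV
      = {complex_of_real t * (complex_of_real b + \<i>) | t. True}"
    by auto
  then show ?thesis using b uv \<open>poly_C v\<close> by blast
qed

end
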